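(* Let $n\ge 3$. If $L$ is a non-nilpotent solvable Leibniz superalgebra whose nilradical is a superalgebra $M(\alpha_4,\alpha_5,\dots,\alpha_n,\theta,\tau)$ from the class $M$ defined in the context, then $$\alpha_4=\alpha_5=\dots=\alpha_n=\theta=\tau=0.$$
   Context: All vector spaces are finite-dimensional over $\mathbb C$. A Leibniz superalgebra is a $\mathbb Z_2$-graded vector space $L=L_0\oplus L_1$ with an even (grading-compatible) bilinear product $[-,-]$ such that $[x,[y,z]]=[[x,y],z]-(-1)^{\alpha\beta}[[x,z],y]$ for all $x\in L$, $y\in L_\alpha$, $z\in L_\beta$. Nilpotency and solvability are defined as for Leibniz algebras, via $L^1=L,\ L^{k+1}=[L^k,L]$ and $L^{[1]}=L,\ L^{[k+1]}=[L^{[k]},L^{[k]}]$ respectively. The nilradical of $L$ is the maximal nilpotent ideal $N$ of $L$ such that $[L,L]\subset N$. Class $M(\alpha_4,\dots,\alpha_n,\theta,\tau)$: nilpotent Leibniz superalgebras with even basis $e_1,\dots,e_n$, odd basis $y_1,\dots,y_n$ and the following products (omitted products of basis elements are zero, empty sums are zero; the parameters are complex numbers): $$\begin{aligned} &[e_1,e_1]=e_3,\quad [e_i,e_1]=e_{i+1}\ (2\le i\le n-1),\quad [y_j,e_1]=y_{j+1}\ (1\le j\le n-1),\\ &[e_1,y_1]=\tfrac12y_2,\quad [e_i,y_1]=\tfrac12y_i\ (2\le i\le n),\\ &[y_1,y_1]=e_1,\quad [y_j,y_1]=e_{j+1}\ (2\le j\le n-1),\\ &[e_1,e_2]=\sum_{k=4}^{n-1}\alpha_ke_k+\theta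 e_n,\quad [e_j,e_2]=\sum_{k=4}^{n+2-j}\alpha_ke_{k+j-2}\ (2\le j\le n-2),\\ &[y_1,e_2]=\sum_{k=4}^{n-1}\alpha_ky_{k-1}+\theta y_{n-1}+\tau y_n,\quad [y_2,e_2]=\sum_{k=4}^{n-1}\alpha_ky_k+\theta y_n,\\ &[y_j,e_2]=\sum_{k=4}^{n+2-j}\alpha_ky_{k+j-2}\ (3\le j\le n-2). \end{aligned}$$ *)

theory Defs
  imports Complex_Main
begin

text \<open>
  The superalgebra \<open>L\<close> is the whole type \<open>'a\<close>, regarded as a complex vector space through
  \<open>scale\<close>, with even part \<open>L0\<close> and odd part \<open>L1\<close>. Degrees are natural numbers read modulo 2, and
  \<open>homog d\<close> is the component of degree \<open>d\<close>.
\<close>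

definition homog :: "'a set \<Rightarrow> 'a set \<Rightarrow> nat \<Rightarrow> 'a set" where
  "homog L0 L1 d = (if even d then L0 else L1)"

locale leibniz_superalgebra = vector_space scale
  for scale :: "complex \<Rightarrow> 'a::ab_group_add \<Rightarrow> 'a" +
  fixes L0 L1 :: "'a set"
    and br :: "'a \<Rightarrow> 'a \<Rightarrow> 'a"
  assumes finite_dim: "\<exists>B. finite B \<and> span B = UNIV"
    and subspace_even: "subspace L0"
    and subspace_odd: "subspace L1"
    and parts_disjoint: "L0 \<inter> L1 = {0}"
    and parts_sum: "\<forall>x. \<exists>u\<in>L0. \<exists>v\<in>L1. x = u + v"
    and linear_left: "Vector_Spaces.linear scale scale (\<lambda>x. br x z)"
    and linear_right: "Vector_Spaces.linear scale scale (\<lambda>z. br x z)"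
    and br_graded: "x \<in> homog L0 L1 a \<Longrightarrow> y \<in> homog L0 L1 b \<Longrightarrow> br x y \<in> homog L0 L1 (a + b)"
    and super_leibniz: "y \<in> homog L0 L1 a \<Longrightarrow> z \<in> homog L0 L1 b \<Longrightarrow>
      br x (br y z) = br (br x y) z - scale ((-1) ^ (a * b)) (br (br x z) y)"
begin

definition prod_space :: "'a set \<Rightarrow> 'a set \<Rightarrow> 'a set" where
  "prod_space A B = span {br x y | x y. x \<in> A \<and> y \<in> B}"

text \<open>
  Both series are indexed from 0 rather than from 1: \<open>lower_series S k\<close> is $S^{k+1}$ and
  \<open>derived_series S k\<close> is $S^{[k+1]}$.
\<close>

primrec lower_series :: "'a set \<Rightarrow> nat \<Rightarrow> 'a set" where
  "lower_series S 0 = S"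
| "lower_series S (Suc k) = prod_space (lower_series S k) S"

primrec derived_series :: "'a set \<Rightarrow> nat \<Rightarrow> 'a set" where
  "derived_series S 0 = S"
| "derived_series S (Suc k) = prod_space (derived_series S k) (derived_series S k)"

definition nilpotent :: "'a set \<Rightarrow> bool" where
  "nilpotent S \<longleftrightarrow> (\<exists>k. lower_series S k = {0})"

definition solvable :: "'a set \<Rightarrow> bool" where
  "solvable S \<longleftrightarrow> (\<exists>k. derived_series S k = {0})"

definition graded_subspace :: "'a set \<Rightarrow> bool" where
  "graded_subspace S \<longleftrightarrow>
     subspace S \<and> (\<forall>x\<in>S. \<exists>u\<in>S \<inter> L0. \<exists>v\<in>S \<inter> L1. x = u + v)"

text \<open>Ideals of a superalgebra are two-sided and graded.\<close>

definition ideal :: "'a set \<Rightarrow> bool" where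
  "ideal I \<longleftrightarrow> graded_subspace I \<and> (\<forall>x\<in>I. \<forall>z. br x z \<in> I \<and> br z x \<in> I)"

definition nilradical :: "'a set \<Rightarrow> bool" where
  "nilradical N \<longleftrightarrow>
     ideal N \<and> nilpotent N \<and> prod_space UNIV UNIV \<subseteq> N \<and>
     (\<forall>I. ideal I \<and> nilpotent I \<and> prod_space UNIV UNIV \<subseteq> I \<and> N \<subseteq> I \<longrightarrow> I = N)"

definition is_basis_of :: "nat \<Rightarrow> (nat \<Rightarrow> 'a) \<Rightarrow> 'a set \<Rightarrow> bool" where
  "is_basis_of n b S \<longleftrightarrow> inj_on b {1..n} \<and> independent (b ` {1..n}) \<and> span (b ` {1..n}) = S"

text \<open>
  Multiplication table of $M(\alpha_4,\dots,\alpha_n,\theta,\tau)$ on basis vectors with indices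
  in \<open>{1..n}\<close>: for instance \<open>M_ye\<close> \<open>i j\<close> is the value of $[y_i,e_j]$. Only the values of
  \<open>\<alpha>\<close> on \<open>{4..n}\<close> occur.
\<close>

definition M_ee ::
  "nat \<Rightarrow> (nat \<Rightarrow> complex) \<Rightarrow> complex \<Rightarrow> (nat \<Rightarrow> 'a) \<Rightarrow> nat \<Rightarrow> nat \<Rightarrow> 'a" where
  "M_ee n \<alpha> \<theta> e i j =
     (if j = 1 then
        (if i = 1 then e 3
         else if 2 \<le> i \<and> i \<le> n - 1 then e (i + 1)
         else 0)
      else if j = 2 then
        (if i = 1 then (\<Sum>k=4..n-1. scale (\<alpha> k) (e k)) + scale \<theta> (e n)
         else if 2 \<le> i \<and> i \<le> n - 2 then (\<Sum>k=4..n+2-i. scale (\<alpha> k) (e (k + i - 2)))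
         else 0)
      else 0)"

definition M_ey :: "nat \<Rightarrow> (nat \<Rightarrow> 'a) \<Rightarrow> nat \<Rightarrow> nat \<Rightarrow> 'a" where
  "M_ey n y i j =
     (if j = 1 then
        (if i = 1 then scale (1/2) (y 2)
         else if 2 \<le> i \<and> i \<le> n then scale (1/2) (y i)
         else 0)
      else 0)"

definition M_ye ::
  "nat \<Rightarrow> (nat \<Rightarrow> complex) \<Rightarrow> complex \<Rightarrow> complex \<Rightarrow> (nat \<Rightarrow> 'a) \<Rightarrow> nat \<Rightarrow> nat \<Rightarrow> 'a" where
  "M_ye n \<alpha> \<theta> \<tau> y i j =
     (if j = 1 then
        (if 1 \<le> i \<and> i \<le> n - 1 then y (i + 1) else 0)
      else if j = 2 then
        (if i = 1 then (\<Sum>k=4..n-1. scale (\<alpha> k) (y (k - 1))) + scale \<theta> (y (n - 1)) + scale \<tau> (y n)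
         else if i = 2 then (\<Sum>k=4..n-1. scale (\<alpha> k) (y k)) + scale \<theta> (y n)
         else if 3 \<le> i \<and> i \<le> n - 2 then (\<Sum>k=4..n+2-i. scale (\<alpha> k) (y (k + i - 2)))
         else 0)
      else 0)"

definition M_yy :: "nat \<Rightarrow> (nat \<Rightarrow> 'a) \<Rightarrow> nat \<Rightarrow> nat \<Rightarrow> 'a" where
  "M_yy n e i j =
     (if j = 1 then
        (if i = 1 then e 1
         else if 2 \<le> i \<and> i \<le> n - 1 then e (i + 1)
         else 0)
      else 0)"

text \<open>
  \<open>is_M n \<alpha> \<theta> \<tau> N\<close>: the graded subspace \<open>N\<close>, with the induced bracket, is a superalgebra
  $M(\alpha_4,\dots,\alpha_n,\theta,\tau)$. Closure under the bracket follows from the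
  multiplication table, and the superidentity is inherited from the ambient superalgebra.
\<close>

definition is_M ::
  "nat \<Rightarrow> (nat \<Rightarrow> complex) \<Rightarrow> complex \<Rightarrow> complex \<Rightarrow> 'a set \<Rightarrow> bool" where
  "is_M n \<alpha> \<theta> \<tau> N \<longleftrightarrow>
     graded_subspace N \<and> nilpotent N \<and>
     (\<exists>e y. is_basis_of n e (N \<inter> L0) \<and> is_basis_of n y (N \<inter> L1) \<and>
        (\<forall>i\<in>{1..n}. \<forall>j\<in>{1..n}.
           br (e i) (e j) = M_ee n \<alpha> \<theta> e i j \<and>
           br (e i) (y j) = M_ey n y i j \<and>
           br (y i) (e j) = M_ye n \<alpha> \<theta> \<tau> y i j \<and>
           br (y i) (y j) = M_yy n e i j))"

end

end

theory Submission
  imports Defs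
begin

text \<open>
  Give $y_i$ the weight $2i-1$, $e_1$ the weight $2$ and $e_i$ with $i \ge 2$ the weight $2i-2$.
  Without the parameters, the multiplication table is additive in the weights. A parameter stands
  in front of a vector that is too heavy: $[e_2,e_2]$ should have weight $4$, but $e_k$ with
  $k \ge 4$ has weight $2k-2 \ge 6$; and $[y_1,e_2]$ should have weight $3$, but $y_n$ has weight
  $2n-1 \ge 5$. So a diagonalizable derivation whose eigenvalues are proportional to the weights
  kills all $\alpha_k$ and $\tau$, and a non-nilpotent extension $L$ of $N$ supplies something close enough
  to such a derivation.

  Let $F_w$ be spanned by the basis vectors of weight at least $w$. The parameter terms never
  lower weights, so $[F_v,F_w] \subseteq F_{v+w}$ (\<open>br_F_F\<close>). Take a homogeneous $x$ outside $N$. Right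
  multiplication by $x$ is a superderivation of $N$, and $N$ is generated by $y_1$ and $e_2$. The
  coincidences $[e_1,e_1] = e_3 = [e_2,e_1]$ and the absence of $e_3$ from $[e_2,e_2]$ tie its
  values on the two generators together: there is one number $a$ such that $x$ acts as the scalar
  $wa$ on $F_w/F_{w+1}$, with $a = 0$ if $x$ is odd (\<open>even_acts_with_eigenvalue\<close>,
  \<open>odd_acts_with_eigenvalue_0\<close>, \<open>eigenvalue_on_basis\<close>).

  If $a = 0$, then $x$ and all of $N$ multiply $F_w$ into $F_{w+1}$ from the right, so
  $N + \mathbb{C}x$ is a nilpotent ideal (\<open>eigenvalue_0_nilpotent\<close>), contrary to the maximality of
  $N$. So $x$ is even and $a \ne 0$. If $\alpha_m$ is the first nonzero $\alpha$, then applying $x$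
  to $[e_2,e_2] = \alpha_m e_m + \cdots$ shows that the eigenvalues $4a$ and $(2m-2)a$ agree, which
  is absurd (\<open>nonzero_eigenvalue_\<alpha>_zero\<close>); once all $\alpha$ vanish, the same argument for
  $[y_1,e_2] = \tau y_n$ compares $3a$ with $(2n-1)a$ (\<open>nonzero_eigenvalue_\<tau>_zero\<close>).

  Weights alone do not decide about $\theta$, because $e_n$ has the weight $4$ of $[e_1,e_2]$ when
  $n = 3$. Here the superidentity for $e_2, e_2, y_1$ helps: it forces $\theta = \alpha_n$ if
  $n \ge 4$ and $\theta = 0$ if $n = 3$ (\<open>is_M_imp_M_table\<close>).
\<close>

section \<open>Brackets and nilradicals of Leibniz superalgebras\<close>

context leibniz_superalgebra
begin

lemma br_add_left: "br (u + v) z = br u z + br v z"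
  using module_hom.add[of scale scale "\<lambda>x. br x z" u v] linear_left[of z]
  by (simp add: module_hom_iff_linear)

lemma br_add_right: "br z (u + v) = br z u + br z v"
  using module_hom.add[of scale scale "br z" u v] linear_right[of z]
  by (simp add: module_hom_iff_linear)

lemma br_scale_left: "br (scale c u) z = scale c (br u z)"
  using module_hom.scale[of scale scale "\<lambda>x. br x z" c u] linear_left[of z]
  by (simp add: module_hom_iff_linear)

lemma br_scale_right: "br z (scale c u) = scale c (br z u)"
  using module_hom.scale[of scale scale "br z" c u] linear_right[of z]
  by (simp add: module_hom_iff_linear)

lemma br_zero_left [simp]: "br 0 z = 0"
  using br_scale_left[of 0 0 z] by simp

lemma br_zero_right [simp]: "br z 0 = 0"
  using br_scale_right[of z 0 0] by simp

lemma br_diff_left: "br (u - v) z = br u z - br v z"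
  using br_add_left[of "u - v" v z] by (simp add: algebra_simps)

lemma br_diff_right: "br z (u - v) = br z u - br z v"
  using br_add_right[of z "u - v" v] by (simp add: algebra_simps)

lemma br_sum_left: "br (\<Sum>k\<in>A. f k) z = (\<Sum>k\<in>A. br (f k) z)"
  by (induction A rule: infinite_finite_induct) (simp_all add: br_add_left)

lemmas br_bilinear = br_add_left br_add_right br_diff_left br_diff_right
  br_scale_left br_scale_right

lemma br_span_left:
  assumes "u \<in> span B" "subspace T" "\<And>b. b \<in> B \<Longrightarrow> br b z \<in> T"
  shows "br u z \<in> T"
  using assms(1)
proof (induction rule: span_induct_alt)
  case base
  then show ?case using assms(2) by (simp add: subspace_0)
next
  case (step c b u)
  then show ?case
    using assms(2,3) by (simp add: br_add_left br_scale_left subspace_add subspace_scale)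
qed

lemma br_span_right:
  assumes "u \<in> span B" "subspace T" "\<And>b. b \<in> B \<Longrightarrow> br z b \<in> T"
  shows "br z u \<in> T"
  using assms(1)
proof (induction rule: span_induct_alt)
  case base
  then show ?case using assms(2) by (simp add: subspace_0)
next
  case (step c b u)
  then show ?case
    using assms(2,3) by (simp add: br_add_right br_scale_right subspace_add subspace_scale)
qed

text \<open>
  The superidentity, read as a product rule for right multiplication by \<open>x\<close>. The sign depends on
  the parities of \<open>v\<close> and \<open>x\<close> only, so \<open>u\<close> may be inhomogeneous.
\<close>

lemma derivation_even:
  assumes "v \<in> L0" "x \<in> homog L0 L1 d"
  shows "br (br u v) x = br u (br v x) + br (br u x) v"
  using super_leibniz[of v 0 x d u] assms by (simp add: homog_def)

lemma derivation_odd: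
  assumes "v \<in> L1" "x \<in> homog L0 L1 d"
  shows "br (br u v) x = br u (br v x) + scale ((-1) ^ d) (br (br u x) v)"
  using super_leibniz[of v 1 x d u] assms by (simp add: homog_def)

text \<open>
  Adjoining one homogeneous element to the nilradical keeps it a graded ideal, because it already
  contains every product; so maximality can only be respected if nilpotency is lost.
\<close>

lemma nilradical_adjoin_not_nilpotent:
  assumes N: "nilradical N" and x: "x \<in> homog L0 L1 d" "x \<notin> N"
  shows "\<not> nilpotent (span (insert x N))"
proof
  let ?I = "span (insert x N)"
  assume nil: "nilpotent ?I"
  have gN: "graded_subspace N" and prod: "prod_space UNIV UNIV \<subseteq> N"
    using N by (auto simp: nilradical_def ideal_def)
  have sub: "subspace N" using gN by (simp add: graded_subspace_def)
  have NI: "N \<subseteq> ?I" using span_superset by blast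
  have xI: "x \<in> ?I" by (simp add: span_base)
  have brN: "br u v \<in> N" for u v
    using prod by (auto simp: prod_space_def intro: span_base)
  have "\<exists>u\<in>?I \<inter> L0. \<exists>v\<in>?I \<inter> L1. z = u + v" if z: "z \<in> ?I" for z
  proof -
    obtain k where k: "z - scale k x \<in> N"
      using z sub by (auto simp: span_insert span_eq_iff[THEN iffD2])
    then obtain u v where uv: "u \<in> N \<inter> L0" "v \<in> N \<inter> L1" "z - scale k x = u + v"
      using gN unfolding graded_subspace_def by blast
    show ?thesis
    proof (cases "even d")
      case True
      then have "scale k x + u \<in> ?I \<inter> L0"
        using x uv NI xI subspace_even
        by (auto simp: homog_def intro!: span_add span_scale subspace_add subspace_scale)
      moreover have "z = (scale k x + u) + v" using uv by (simp add: algebra_simps)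
      ultimately show ?thesis using uv NI by blast
    next
      case False
      then have "scale k x + v \<in> ?I \<inter> L1"
        using x uv NI xI subspace_odd
        by (auto simp: homog_def intro!: span_add span_scale subspace_add subspace_scale)
      moreover have "z = u + (scale k x + v)" using uv by (simp add: algebra_simps)
      ultimately show ?thesis using uv NI by blast
    qed
  qed
  then have "ideal ?I"
    using brN NI by (auto simp: ideal_def graded_subspace_def)
  then have "?I = N" using N nil prod NI unfolding nilradical_def by blast
  then show False using xI x by blast
qed

lemma ex_homogeneous_outside:
  assumes "subspace N" "N \<noteq> UNIV"
  shows "\<exists>d x. x \<in> homog L0 L1 d \<and> x \<notin> N"
proof (rule ccontr)
  assume *: "\<not> ?thesis"
  have "L0 \<subseteq> N" using * by (force simp: homog_def dest: spec[of _ 0])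
  moreover have "L1 \<subseteq> N" using * by (force simp: homog_def dest: spec[of _ 1])
  ultimately have "z \<in> N" for z
    using parts_sum assms(1) by (metis subset_eq subspace_add)
  then show False using assms(2) by blast
qed

end

section \<open>The weight filtration of the algebra M\<close>

text \<open>
  The multiplication table in a normal form without boundary cases: the basis families are
  continued by zero, so that all sums may run up to \<open>n\<close>. The parameter $\theta$ is absent since the
  superidentity expresses it through \<open>\<alpha>\<close>; this also makes $[y_2,e_2]$ an instance of the general
  rule for $[y_i,e_2]$ with $i \ge 2$.
\<close>

locale M_table = leibniz_superalgebra scale L0 L1 br
  for scale :: "complex \<Rightarrow> 'a::ab_group_add \<Rightarrow> 'a" and L0 L1 br +
  fixes n :: nat and \<alpha> :: "nat \<Rightarrow> complex" and \<tau> :: complex and e y :: "nat \<Rightarrow> 'a"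
  assumes n3: "n \<ge> 3"
    and e_even: "e i \<in> L0" and y_odd: "y i \<in> L1"
    and e_zero: "i \<notin> {1..n} \<Longrightarrow> e i = 0" and y_zero: "i \<notin> {1..n} \<Longrightarrow> y i = 0"
    and e_inj: "inj_on e {1..n}" and e_indep: "independent (e ` {1..n})"
    and y_inj: "inj_on y {1..n}" and y_indep: "independent (y ` {1..n})"
    and e1e1: "br (e 1) (e 1) = e 3" and ee1: "2 \<le> i \<Longrightarrow> br (e i) (e 1) = e (i + 1)"
    and ye1: "1 \<le> i \<Longrightarrow> br (y i) (e 1) = y (i + 1)"
    and e1y1: "br (e 1) (y 1) = scale (1/2) (y 2)"
    and ey1: "2 \<le> i \<Longrightarrow> br (e i) (y 1) = scale (1/2) (y i)"
    and y1y1: "br (y 1) (y 1) = e 1" and yy1: "2 \<le> i \<Longrightarrow> br (y i) (y 1) = e (i + 1)"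
    and e1e2: "br (e 1) (e 2) = (\<Sum>k=4..n. scale (\<alpha> k) (e k))"
    and ee2: "2 \<le> i \<Longrightarrow> br (e i) (e 2) = (\<Sum>k=4..n. scale (\<alpha> k) (e (k + i - 2)))"
    and y1e2: "br (y 1) (e 2) = (\<Sum>k=4..n. scale (\<alpha> k) (y (k - 1))) + scale \<tau> (y n)"
    and ye2: "2 \<le> i \<Longrightarrow> br (y i) (e 2) = (\<Sum>k=4..n. scale (\<alpha> k) (y (k + i - 2)))"
    and ee0: "3 \<le> j \<Longrightarrow> br (e i) (e j) = 0" and ye0: "3 \<le> j \<Longrightarrow> br (y i) (e j) = 0"
    and ey0: "2 \<le> j \<Longrightarrow> br (e i) (y j) = 0" and yy0: "2 \<le> j \<Longrightarrow> br (y i) (y j) = 0"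
begin

text \<open>
  The weights count generators: $1$ for $y_1$, and $2$ for $e_2$ as well as for $e_1 = [y_1,y_1]$.
  Index 0 gets weight 0, which is harmless because it belongs to the zero vector.
\<close>

definition e_weight :: "nat \<Rightarrow> nat" where
  "e_weight i = (if i = 1 then 2 else 2 * i - 2)"

definition y_weight :: "nat \<Rightarrow> nat" where
  "y_weight i = 2 * i - 1"

definition F :: "nat \<Rightarrow> 'a set" where
  "F w = span ({e i | i. w \<le> e_weight i} \<union> {y i | i. w \<le> y_weight i})"

lemma subspace_F: "subspace (F w)"
  by (simp add: F_def subspace_span)

lemmas F_rules = subspace_add[OF subspace_F] subspace_diff[OF subspace_F]
  subspace_scale[OF subspace_F] subspace_sum[OF subspace_F] subspace_0[OF subspace_F]

lemma F_antimono: "v \<le> w \<Longrightarrow> F w \<subseteq> F v"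
  unfolding F_def by (rule span_mono) auto

lemma e_in_F: "w \<le> e_weight i \<Longrightarrow> e i \<in> F w"
  unfolding F_def by (rule span_base) auto

lemma y_in_F: "w \<le> y_weight i \<Longrightarrow> y i \<in> F w"
  unfolding F_def by (rule span_base) auto

lemma e_0: "e 0 = 0" and y_0: "y 0 = 0"
  by (simp_all add: e_zero y_zero)

lemma br_F_right_trivial:
  assumes "u \<in> F 0"
  shows "3 \<le> j \<Longrightarrow> br u (e j) = 0" and "2 \<le> j \<Longrightarrow> br u (y j) = 0"
  using br_span_left[OF assms[unfolded F_def] subspace_single_0, of "e j"]
    br_span_left[OF assms[unfolded F_def] subspace_single_0, of "y j"]
  by (force simp: ee0 ye0 ey0 yy0)+

text \<open>
  Only $y_1$, $e_1$ and $e_2$ act nontrivially from the right, so this is all of the table: each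
  entry lies at least as deep in the filtration as the weights of its factors predict.
\<close>

lemma br_F_generators:
  assumes "u \<in> F w"
  shows "br u (y 1) \<in> F (w + 1)" and "br u (e 1) \<in> F (w + 2)" and "br u (e 2) \<in> F (w + 2)"
proof -
  \<comment> \<open>The index 1 obeys its own rules in the table, and index 0 stands for the zero vector.\<close>
  have cases: Q
    if b: "b \<in> {e i | i. w \<le> e_weight i} \<union> {y i | i. w \<le> y_weight i}"
      and zero: "b = 0 \<Longrightarrow> Q" and e1: "w \<le> 2 \<Longrightarrow> b = e 1 \<Longrightarrow> Q"
      and e: "\<And>i. 2 \<le> i \<Longrightarrow> w \<le> 2 * i - 2 \<Longrightarrow> b = e i \<Longrightarrow> Q"
      and y1: "w \<le> 1 \<Longrightarrow> b = y 1 \<Longrightarrow> Q"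
      and y: "\<And>i. 2 \<le> i \<Longrightarrow> w \<le> 2 * i - 1 \<Longrightarrow> b = y i \<Longrightarrow> Q" for b Q
  proof -
    consider i where "b = e i" "w \<le> e_weight i" | i where "b = y i" "w \<le> y_weight i"
      using b by blast
    then show Q
    proof cases
      case 1
      consider "i = 0" | "i = 1" | "2 \<le> i" by linarith
      then show Q using 1 zero e1 e e_0 by cases (auto simp: e_weight_def)
    next
      case 2
      consider "i = 0" | "i = 1" | "2 \<le> i" by linarith
      then show Q using 2 zero y1 y y_0 by cases (auto simp: y_weight_def)
    qed
  qed
  show "br u (y 1) \<in> F (w + 1)"
  proof (rule br_span_left[OF assms[unfolded F_def] subspace_F])
    fix b assume "b \<in> {e i | i. w \<le> e_weight i} \<union> {y i | i. w \<le> y_weight i}"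
    then show "br b (y 1) \<in> F (w + 1)"
      by (rule cases)
        (auto simp: e1y1[simplified] ey1[simplified] y1y1[simplified] yy1[simplified]
            F_rules e_weight_def y_weight_def
          intro!: F_rules e_in_F y_in_F)
  qed
  show "br u (e 1) \<in> F (w + 2)"
  proof (rule br_span_left[OF assms[unfolded F_def] subspace_F])
    fix b assume "b \<in> {e i | i. w \<le> e_weight i} \<union> {y i | i. w \<le> y_weight i}"
    then show "br b (e 1) \<in> F (w + 2)"
      by (rule cases)
        (auto simp: e1e1[simplified] ee1[simplified] ye1[simplified] F_rules e_weight_def y_weight_def
          intro!: F_rules e_in_F y_in_F)
  qed
  show "br u (e 2) \<in> F (w + 2)"
  proof (rule br_span_left[OF assms[unfolded F_def] subspace_F])
    fix b assume "b \<in> {e i | i. w \<le> e_weight i} \<union> {y i | i. w \<le> y_weight i}"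
    then show "br b (e 2) \<in> F (w + 2)"
      using n3 by (elim cases)
        (auto simp: e1e2[simplified] ee2 y1e2[simplified] ye2 F_rules e_weight_def y_weight_def
          intro!: F_rules e_in_F y_in_F)
  qed
qed

lemma br_F_F:
  assumes "u \<in> F i" "v \<in> F j"
  shows "br u v \<in> F (i + j)"
proof (rule br_span_right[OF assms(2)[unfolded F_def] subspace_F])
  have u0: "u \<in> F 0" using assms(1) F_antimono[of 0 i] by blast
  fix b assume "b \<in> {e k | k. j \<le> e_weight k} \<union> {y k | k. j \<le> y_weight k}"
  then consider k where "b = e k" "j \<le> e_weight k" | k where "b = y k" "j \<le> y_weight k"
    by blast
  then show "br u b \<in> F (i + j)"
  proof cases
    case 1
    consider "k = 0" | "k = 1" | "k = 2" | "3 \<le> k" by linarith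
    then show ?thesis
    proof cases
      case 1
      then show ?thesis using \<open>b = e k\<close> by (simp add: e_0 F_rules)
    next
      case 2
      then show ?thesis
        using 1 br_F_generators(2)[OF assms(1)] F_antimono[of "i + j" "i + 2"]
        by (auto simp: e_weight_def)
    next
      case 3
      then show ?thesis
        using 1 br_F_generators(3)[OF assms(1)] F_antimono[of "i + j" "i + 2"]
        by (auto simp: e_weight_def)
    next
      case 4
      then show ?thesis using 1 br_F_right_trivial(1)[OF u0] by (simp add: F_rules)
    qed
  next
    case 2
    consider "k = 0" | "k = 1" | "2 \<le> k" by linarith
    then show ?thesis
    proof cases
      case 1
      then show ?thesis using \<open>b = y k\<close> by (simp add: y_0 F_rules)
    next
      case 2
      then show ?thesis
        using \<open>b = y k\<close> \<open>j \<le> y_weight k\<close> br_F_generators(1)[OF assms(1)]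
          F_antimono[of "i + j" "i + 1"]
        by (auto simp: y_weight_def)
    next
      case 3
      then show ?thesis using 2 br_F_right_trivial(2)[OF u0] by (simp add: F_rules)
    qed
  qed
qed

text \<open>
  This is what makes the product rule effective: in $[u,[v,x]]$ the correction terms of weight at
  least 3 in $[v,x]$ disappear entirely.
\<close>

lemma br_F_3_right:
  assumes "u \<in> F 0" "v \<in> F 3"
  shows "br u v = 0"
proof -
  have "br u v \<in> {0}"
  proof (rule br_span_right[OF assms(2)[unfolded F_def]])
    fix b assume "b \<in> {e k | k. 3 \<le> e_weight k} \<union> {y k | k. 3 \<le> y_weight k}"
    then consider k where "b = e k" "3 \<le> k" | k where "b = y k" "2 \<le> k"
      by (fastforce simp: e_weight_def y_weight_def split: if_splits)
    then show "br u b \<in> {0}"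
      using br_F_right_trivial[OF assms(1)] by cases auto
  qed simp
  then show ?thesis by simp
qed

lemma F_top: "F (2 * n) = {0}"
proof -
  have "e i = 0" if "2 * n \<le> e_weight i" for i
    using that n3 by (intro e_zero) (auto simp: e_weight_def split: if_splits)
  moreover have "y i = 0" if "2 * n \<le> y_weight i" for i
    using that n3 by (intro y_zero) (auto simp: y_weight_def)
  ultimately have "F (2 * n) \<subseteq> span {0}"
    unfolding F_def by (intro span_mono) auto
  then show ?thesis using F_rules(5) by auto
qed

lemma F_splits:
  assumes "z \<in> F w"
  obtains u v where "z = u + v" "u \<in> span {e i | i. w \<le> e_weight i}" "u \<in> L0"
    "v \<in> span {y i | i. w \<le> y_weight i}" "v \<in> L1"
proof -
  have "z \<in> (\<lambda>(a, b). a + b) ` (span {e i | i. w \<le> e_weight i} \<times> span {y i | i. w \<le> y_weight i})"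
    using assms by (auto simp add: F_def span_Un)
  then obtain u v where uv: "u \<in> span {e i | i. w \<le> e_weight i}"
    "v \<in> span {y i | i. w \<le> y_weight i}" and z: "z = u + v"
    by auto
  have "span {e i | i. w \<le> e_weight i} \<subseteq> L0"
    by (rule span_minimal) (use e_even subspace_even in auto)
  moreover have "span {y i | i. w \<le> y_weight i} \<subseteq> L1"
    by (rule span_minimal) (use y_odd subspace_odd in auto)
  ultimately show thesis using uv z by (intro that[of u v]) (erule subsetD | assumption)+
qed

lemma independent_not_in_span_family:
  assumes "independent (b ` {1..n})" "inj_on b {1..n}" "\<And>i. i \<notin> {1..n} \<Longrightarrow> b i = 0"
    "m \<in> {1..n}" "m \<notin> A"
  shows "b m \<notin> span {b i | i. i \<in> A}"
proof
  assume "b m \<in> span {b i | i. i \<in> A}"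
  moreover have "{b i | i. i \<in> A} \<subseteq> insert 0 (b ` {1..n} - {b m})"
  proof -
    have "b i \<in> insert 0 (b ` {1..n} - {b m})" if "i \<in> A" for i
    proof (cases "i \<in> {1..n}")
      case True
      have "i \<noteq> m" using that assms(5) by blast
      then have "b i \<noteq> b m" using inj_onD[OF assms(2) _ True assms(4)] by metis
      then show ?thesis using True by simp
    qed (simp add: assms(3))
    then show ?thesis by (auto simp del: insert_iff)
  qed
  ultimately have "b m \<in> span (insert 0 (b ` {1..n} - {b m}))"
    by (meson span_mono subsetD)
  then have "b m \<in> span (b ` {1..n} - {b m})"
    by (simp only: span_insert_0)
  moreover have "b m \<in> b ` {1..n}" using assms(4) by (rule imageI)
  ultimately show False using assms(1) unfolding dependent_def by blast
qed

text \<open>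
  The next two lemmas extract coefficients. The two bases are independent separately, and what
  makes their union independent is that the even and the odd part meet trivially.
\<close>

lemma e_coefficient_zero:
  assumes "m \<in> {1..n}" "e_weight m < w" "scale c (e m) \<in> F w"
  shows "c = 0"
proof (rule ccontr)
  assume "c \<noteq> 0"
  then have "e m \<in> F w" using F_rules(3)[OF assms(3), of "1 / c"] by simp
  then obtain u v where uv: "e m = u + v" "u \<in> span {e i | i. w \<le> e_weight i}" "u \<in> L0"
    "v \<in> L1" by (rule F_splits)
  then have "v = e m - u" by simp
  then have "v \<in> L0" using subspace_diff[OF subspace_even e_even uv(3)] by simp
  then have "v = 0" using uv(4) parts_disjoint by auto
  then have "e m \<in> span {e i | i. i \<in> {i. w \<le> e_weight i}}" using uv by simp
  then show False
    using independent_not_in_span_family[OF e_indep e_inj e_zero assms(1),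
        of "{i. w \<le> e_weight i}"] assms(2)
    by simp
qed

lemma y_coefficient_zero:
  assumes "m \<in> {1..n}" "y_weight m < w" "scale c (y m) \<in> F w"
  shows "c = 0"
proof (rule ccontr)
  assume "c \<noteq> 0"
  then have "y m \<in> F w" using F_rules(3)[OF assms(3), of "1 / c"] by simp
  then obtain u v where uv: "y m = u + v" "v \<in> span {y i | i. w \<le> y_weight i}" "u \<in> L0"
    "v \<in> L1" by (rule F_splits)
  then have "u = y m - v" by simp
  then have "u \<in> L1" using subspace_diff[OF subspace_odd y_odd uv(4)] by simp
  then have "u = 0" using uv(3) parts_disjoint by auto
  then have "y m \<in> span {y i | i. i \<in> {i. w \<le> y_weight i}}" using uv by simp
  then show False
    using independent_not_in_span_family[OF y_indep y_inj y_zero assms(1),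
        of "{i. w \<le> y_weight i}"] assms(2)
    by simp
qed

lemma F_0_even:
  assumes "z \<in> F 0" "z \<in> L0"
  shows "z \<in> F 2" and "\<exists>b c. z - scale b (e 2) - scale c (e 1) \<in> F 3"
proof -
  obtain u v where uv: "z = u + v" "u \<in> span (range e)" "u \<in> L0" "v \<in> L1"
    by (rule F_splits[OF assms(1)]) (simp add: full_SetCompr_eq that)
  then have "v = z - u" by simp
  then have "v \<in> L0" using subspace_diff[OF subspace_even assms(2) uv(3)] by simp
  then have "v = 0" using uv(4) parts_disjoint by auto
  then have z: "z \<in> span (range e)" using uv by simp
  have e3: "e i \<in> F 3" if "i \<noteq> 1" "i \<noteq> 2" for i
    using that e_in_F[of 3 i] e_0 F_rules(5) by (cases "i = 0") (auto simp: e_weight_def)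
  have "e i \<in> insert (e 2) (insert (e 1) (F 3))" for i
    using e3[of i] by auto
  then have "range e \<subseteq> insert (e 2) (insert (e 1) (F 3))" by blast
  then have "z \<in> span (insert (e 2) (insert (e 1) (F 3)))" using z span_mono by blast
  then show ex: "\<exists>b c. z - scale b (e 2) - scale c (e 1) \<in> F 3"
    unfolding span_insert span_eq_iff[THEN iffD2, OF subspace_F] by blast
  then obtain b c where bc: "z - scale b (e 2) - scale c (e 1) \<in> F 2"
    using F_antimono[of 2 3] by auto
  have "z = (z - scale b (e 2) - scale c (e 1)) + scale b (e 2) + scale c (e 1)"
    by simp
  also have "\<dots> \<in> F 2"
    by (intro F_rules(1,3) bc e_in_F) (simp_all add: e_weight_def)
  finally show "z \<in> F 2" .
qed

lemma F_0_odd: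
  assumes "z \<in> F 0" "z \<in> L1"
  shows "\<exists>c. z - scale c (y 1) \<in> F 3"
proof -
  obtain u v where uv: "z = u + v" "v \<in> span (range y)" "u \<in> L0" "v \<in> L1"
    by (rule F_splits[OF assms(1)]) (simp add: full_SetCompr_eq that)
  then have "u = z - v" by simp
  then have "u \<in> L1" using subspace_diff[OF subspace_odd assms(2) uv(4)] by simp
  then have "u = 0" using uv(3) parts_disjoint by auto
  then have z: "z \<in> span (range y)" using uv by simp
  have y3: "y i \<in> F 3" if "i \<noteq> 1" for i
    using that y_in_F[of 3 i] y_0 F_rules(5) by (cases "i = 0") (auto simp: y_weight_def)
  have "y i \<in> insert (y 1) (F 3)" for i
    using y3[of i] by auto
  then have "range y \<subseteq> insert (y 1) (F 3)" by blast
  then have "z \<in> span (insert (y 1) (F 3))" using z span_mono by blast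
  then show ?thesis
    unfolding span_insert span_eq_iff[THEN iffD2, OF subspace_F] by blast
qed

text \<open>
  The algebra itself is \<open>F 0\<close>; that it is also \<open>F 1\<close> means that every right multiplication by one
  of its elements raises weights.
\<close>

lemma F_0_eq_F_1: "F 0 = F 1"
proof
  have "i = 0 \<or> 1 \<le> e_weight i" for i
    by (auto simp: e_weight_def)
  then have "e i \<in> F 1" for i
    using e_in_F[of 1 i] e_0 F_rules(5) by metis
  moreover have "y i \<in> F 1" for i
    using y_in_F[of 1 i] y_0 F_rules(5) by (cases "i = 0") (auto simp: y_weight_def)
  ultimately show "F 0 \<subseteq> F 1"
    unfolding F_def[of 0] by (intro span_minimal subspace_F) auto
qed (simp add: F_antimono)

lemma F_cong_trans: "u - v \<in> F w \<Longrightarrow> u - v' \<in> F w \<Longrightarrow> v - v' \<in> F w"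
  using F_rules(2)[of "u - v'" w "u - v"] by simp

section \<open>Right multiplications act through the weights\<close>

text \<open>
  The vectors of weight at most 2 suffice: for homogeneous \<open>x\<close> this condition propagates to scalar
  action by \<open>w * a\<close> in every weight \<open>w\<close>.
\<close>

definition acts_with_eigenvalue :: "complex \<Rightarrow> 'a \<Rightarrow> bool" where
  "acts_with_eigenvalue a x \<longleftrightarrow>
     br (y 1) x - scale a (y 1) \<in> F 2 \<and>
     br (e 1) x - scale (2 * a) (e 1) \<in> F 3 \<and>
     br (e 2) x - scale (2 * a) (e 2) \<in> F 3"

text \<open>
  If \<open>x\<close> acts on \<open>u\<close> as \<open>c\<close> up to heavier terms, then it acts on $[u,e_1]$ as \<open>c + 2 * a\<close>. Since $e_1$
  is even, no sign appears, and even and odd \<open>x\<close> can be treated alike.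
\<close>

lemma derivation_step:
  assumes x: "x \<in> homog L0 L1 d" and e1: "br (e 1) x - scale (2 * a) (e 1) \<in> F 3"
    and u: "br u x - scale c u \<in> F w" "u \<in> F 0"
  shows "br (br u (e 1)) x - scale (c + 2 * a) (br u (e 1)) \<in> F (w + 2)"
proof -
  have "br u (br (e 1) x - scale (2 * a) (e 1)) = 0"
    using br_F_3_right[OF u(2) e1] .
  moreover have "br (br u x - scale c u) (e 1) \<in> F (w + 2)"
    using br_F_generators(2)[OF u(1)] .
  moreover have "br (br u (e 1)) x - scale (c + 2 * a) (br u (e 1))
      = br u (br (e 1) x - scale (2 * a) (e 1)) + br (br u x - scale c u) (e 1)"
    using derivation_even[OF e_even x, of u 1]
    by (simp add: br_bilinear scale_left_distrib)
  ultimately show ?thesis by simp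
qed

text \<open>
  Right multiplication by $e_1$ leads from $e_i$ to $e_{i+1}$ (for $i \ge 2$) and from $y_i$ to
  $y_{i+1}$, so everything is determined by the vectors $y_1, e_1, e_2$.
\<close>

lemma eigenvalue_on_basis:
  assumes x: "x \<in> homog L0 L1 d" and a: "acts_with_eigenvalue a x" and i: "1 \<le> i"
  shows "br (e i) x - scale (of_nat (e_weight i) * a) (e i) \<in> F (e_weight i + 1)"
    and "br (y i) x - scale (of_nat (y_weight i) * a) (y i) \<in> F (y_weight i + 1)"
proof -
  have gens: "br (y 1) x - scale a (y 1) \<in> F 2" "br (e 1) x - scale (2 * a) (e 1) \<in> F 3"
    "br (e 2) x - scale (2 * a) (e 2) \<in> F 3"
    using a by (auto simp: acts_with_eigenvalue_def)
  show "br (y i) x - scale (of_nat (y_weight i) * a) (y i) \<in> F (y_weight i + 1)"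
    using i
  proof (induction i rule: nat_induct_at_least)
    case base
    then show ?case using gens(1) by (simp add: y_weight_def numeral_2_eq_2)
  next
    case (Suc i)
    have w: "y_weight (Suc i) = y_weight i + 2"
      using Suc.hyps by (simp add: y_weight_def)
    show ?case
      using derivation_step[OF x gens(2) Suc.IH y_in_F] ye1[OF Suc.hyps]
      by (simp add: w algebra_simps)
  qed
  have "br (e i) x - scale (of_nat (e_weight i) * a) (e i) \<in> F (e_weight i + 1)"
    if "2 \<le> i" for i
    using that
  proof (induction i rule: nat_induct_at_least)
    case base
    then show ?case using gens(3) by (simp add: e_weight_def)
  next
    case (Suc i)
    have w: "e_weight (Suc i) = e_weight i + 2"
      using Suc.hyps by (simp add: e_weight_def)
    show ?case
      using derivation_step[OF x gens(2) Suc.IH e_in_F] ee1[OF Suc.hyps]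
      by (simp add: w algebra_simps)
  qed
  then show "br (e i) x - scale (of_nat (e_weight i) * a) (e i) \<in> F (e_weight i + 1)"
    using i gens(2) by (cases "i = 1") (auto simp: e_weight_def)
qed

lemma eigenvalue_0_raises_F:
  assumes x: "x \<in> homog L0 L1 d" and a: "acts_with_eigenvalue 0 x" and z: "z \<in> F w"
  shows "br z x \<in> F (w + 1)"
proof (rule br_span_left[OF z[unfolded F_def] subspace_F])
  fix b assume "b \<in> {e i | i. w \<le> e_weight i} \<union> {y i | i. w \<le> y_weight i}"
  then consider i where "b = e i" "w \<le> e_weight i" | i where "b = y i" "w \<le> y_weight i"
    by blast
  then show "br b x \<in> F (w + 1)"
  proof cases
    case 1
    then show ?thesis
      using eigenvalue_on_basis(1)[OF x a, of i] F_antimono[of "w + 1" "e_weight i + 1"]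
      by (cases "i = 0") (auto simp: e_0 F_rules)
  next
    case 2
    then show ?thesis
      using eigenvalue_on_basis(2)[OF x a, of i] F_antimono[of "w + 1" "y_weight i + 1"]
      by (cases "i = 0") (auto simp: y_0 F_rules)
  qed
qed

text \<open>
  After one step the lower central series lies in \<open>F 0\<close>, and every later step gains one unit of
  weight until the filtration is exhausted at \<open>2 * n\<close>.
\<close>

lemma eigenvalue_0_nilpotent:
  assumes x: "x \<in> homog L0 L1 d" and a: "acts_with_eigenvalue 0 x"
    and prod: "\<And>u v. br u v \<in> F 0"
  shows "nilpotent (span (insert x (F 0)))"
proof -
  let ?I = "span (insert x (F 0))"
  have "lower_series ?I (Suc k) \<subseteq> F k" for k
  proof (induction k)
    case 0
    have "prod_space ?I ?I \<subseteq> F 0"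
      unfolding prod_space_def by (intro span_minimal subspace_F) (auto simp: prod)
    then show ?case by simp
  next
    case (Suc k)
    have "br u v \<in> F (Suc k)" if u: "u \<in> F k" and v: "v \<in> ?I" for u v
    proof (rule br_span_right[OF v subspace_F])
      fix b assume "b \<in> insert x (F 0)"
      then show "br u b \<in> F (Suc k)"
        using eigenvalue_0_raises_F[OF x a u] br_F_F[OF u, of b 1] F_0_eq_F_1 by auto
    qed
    then have "br u v \<in> F (Suc k)" if "u \<in> lower_series ?I (Suc k)" "v \<in> ?I" for u v
      using Suc that by blast
    then have "prod_space (lower_series ?I (Suc k)) ?I \<subseteq> F (Suc k)"
      unfolding prod_space_def by (intro span_minimal subspace_F) blast
    then show ?case by (simp only: lower_series.simps)
  qed
  then have "lower_series ?I (Suc (2 * n)) \<subseteq> {0}" using F_top by blast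
  moreover have "0 \<in> lower_series ?I (Suc (2 * n))"
    by (simp add: prod_space_def span_zero)
  ultimately have "lower_series ?I (Suc (2 * n)) = {0}" by blast
  then show ?thesis unfolding nilpotent_def by blast
qed

text \<open>
  An odd element exchanges even and odd vectors, hence changes the parity of weights and has no
  weight-preserving part. The only way to fail would be to lower the weight, by sending $e_2$ to a
  multiple of $y_1$; the two factorizations of $e_3$ exclude that.
\<close>

lemma odd_acts_with_eigenvalue_0:
  assumes x: "x \<in> L1" and prod: "\<And>u v. br u v \<in> F 0"
  shows "acts_with_eigenvalue 0 x"
proof -
  have x1: "x \<in> homog L0 L1 1" using x by (simp add: homog_def)
  have "br (y 1) x \<in> L0"
    using br_graded[of "y 1" 1 x 1] x y_odd by (simp add: homog_def)
  then have y1x: "br (y 1) x \<in> F 2" using F_0_even(1) prod by blast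
  have "br (e 2) x \<in> L1"
    using br_graded[of "e 2" 0 x 1] x e_even by (simp add: homog_def)
  then obtain r where r: "br (e 2) x - scale r (y 1) \<in> F 3" using F_0_odd prod by blast
  have y1F: "y 1 \<in> F 1" and e1F: "e 1 \<in> F 2"
    by (simp_all add: y_in_F e_in_F y_weight_def e_weight_def)
  have "br (e 1) x = br (y 1) (br (y 1) x) - br (br (y 1) x) (y 1)"
    using derivation_odd[OF y_odd x1, of "y 1" 1] by (simp add: y1y1[simplified])
  then have e1x: "br (e 1) x \<in> F 3"
    using br_F_F[OF y1F y1x] br_F_F[OF y1x y1F] F_rules(2) by (simp add: numeral_3_eq_3)
  have e0: "e i \<in> F 0" for i by (simp add: e_in_F)
  \<comment> \<open>Through $e_3 = [e_1,e_1]$ the image of $e_3$ has weight at least 5, but through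
    $e_3 = [e_2,e_1]$ its term of weight 3 is \<open>r\<close> times $y_2$.\<close>
  have "br (e 3) x = br (e 1) (br (e 1) x) + br (br (e 1) x) (e 1)"
    using derivation_even[OF e_even x1, of "e 1" 1] by (simp add: e1e1[simplified])
  then have A: "br (e 3) x \<in> F 5"
    using br_F_3_right[OF e0 e1x] br_F_generators(2)[OF e1x] by simp
  have "br (e 3) x = br (e 2) (br (e 1) x) + br (br (e 2) x) (e 1)"
    using derivation_even[OF e_even x1, of "e 2" 1] ee1[of 2] by simp
  then have "br (e 3) x - scale r (y 2) = br (br (e 2) x - scale r (y 1)) (e 1)"
    using br_F_3_right[OF e0 e1x] ye1[of 1] by (simp add: br_bilinear numeral_2_eq_2)
  then have "br (e 3) x - scale r (y 2) \<in> F 5"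
    using br_F_generators(2)[OF r] by simp
  then have "scale r (y 2) \<in> F 5"
    using F_rules(2)[OF A] by (metis add_diff_cancel_left' diff_add_cancel)
  then have "r = 0"
    using y_coefficient_zero[of 2 5 r] n3 by (simp add: y_weight_def)
  then show ?thesis
    using y1x e1x r by (simp add: acts_with_eigenvalue_def)
qed

text \<open>
  An even \<open>x\<close> sends $y_1$ to $a y_1 + \cdots$ and $e_2$ to $b e_2 + c e_1 + \cdots$ with unknown
  $a, b, c$. Since $e_1 = [y_1,y_1]$ has eigenvalue $2a$, it remains to see that $c = 0$ and
  $b = 2a$.
\<close>

lemma even_acts_with_eigenvalue:
  assumes x: "x \<in> L0" and prod: "\<And>u v. br u v \<in> F 0"
  shows "\<exists>a. acts_with_eigenvalue a x"
proof -
  have x0: "x \<in> homog L0 L1 0" using x by (simp add: homog_def)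
  have "br (y 1) x \<in> L1"
    using br_graded[of "y 1" 1 x 0] x y_odd by (simp add: homog_def)
  then obtain a where a: "br (y 1) x - scale a (y 1) \<in> F 3" using F_0_odd prod by blast
  have "br (e 2) x \<in> L0"
    using br_graded[of "e 2" 0 x 0] x e_even by (simp add: homog_def)
  then obtain b c where bc: "br (e 2) x - scale b (e 2) - scale c (e 1) \<in> F 3"
    using F_0_even(2) prod by blast
  have y0: "y i \<in> F 0" and e0: "e i \<in> F 0" for i by (simp_all add: e_in_F y_in_F)
  define s where "s = br (y 1) x - scale a (y 1)"
  define r where "r = br (e 2) x - scale b (e 2) - scale c (e 1)"
  have s: "s \<in> F 3" and r: "r \<in> F 3" using a bc by (simp_all add: s_def r_def)
  have y1x: "br (y 1) x = scale a (y 1) + s" by (simp add: s_def)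
  have e2x: "br (e 2) x = scale b (e 2) + scale c (e 1) + r" by (simp add: r_def)

  have "br (e 1) x = br (y 1) (br (y 1) x) + br (br (y 1) x) (y 1)"
    using derivation_odd[OF y_odd x0, of "y 1" 1] by (simp add: y1y1[simplified])
  then have "br (e 1) x - scale (2 * a) (e 1) = br s (y 1)"
    using br_F_3_right[OF y0 s]
    by (simp add: y1x[simplified] y1y1[simplified] br_bilinear algebra_simps flip: scale_left_distrib)
  moreover have "br s (y 1) \<in> F 3"
    using br_F_generators(1)[OF s] F_antimono[of 3 4] by auto
  ultimately have e1x: "br (e 1) x - scale (2 * a) (e 1) \<in> F 3" by simp
  define t where "t = br (e 1) x - scale (2 * a) (e 1)"
  have t: "t \<in> F 3" using e1x by (simp add: t_def)
  have e1x': "br (e 1) x = scale (2 * a) (e 1) + t" by (simp add: t_def)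

  \<comment> \<open>The coefficient of $e_3$ in the image of $e_3$ is $4a$ because of $e_3 = [e_1,e_1]$, and
    $2a + b + c$ because of $e_3 = [e_2,e_1]$.\<close>
  have e11: "br (e 1) (e 1) = e 3" and e21: "br (e 2) (e 1) = e 3"
    using e1e1 ee1[of 2] by simp_all
  have "br (e 3) x = br (e 1) (br (e 1) x) + br (br (e 1) x) (e 1)"
    using derivation_even[OF e_even x0, of "e 1" 1] by (simp only: e11)
  then have "br (e 3) x - scale (4 * a) (e 3) = br t (e 1)"
    using br_F_3_right[OF e0 t]
    by (simp only: e1x' e11 br_bilinear) (simp add: algebra_simps flip: scale_left_distrib)
  then have A: "br (e 3) x - scale (4 * a) (e 3) \<in> F 5"
    using br_F_generators(2)[OF t] by simp
  have "br (e 3) x = br (e 2) (br (e 1) x) + br (br (e 2) x) (e 1)"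
    using derivation_even[OF e_even x0, of "e 2" 1] by (simp only: e21)
  then have "br (e 3) x - scale (2 * a + b + c) (e 3) = br r (e 1)"
    using br_F_3_right[OF e0 t]
    by (simp only: e1x' e2x e11 e21 br_bilinear) (simp add: algebra_simps)
  then have "br (e 3) x - scale (2 * a + b + c) (e 3) \<in> F 5"
    using br_F_generators(2)[OF r] by simp
  from F_cong_trans[OF A this] have "scale (4 * a - (2 * a + b + c)) (e 3) \<in> F 5"
    by (simp only: scale_left_diff_distrib)
  then have abc: "4 * a - (2 * a + b + c) = 0"
    using e_coefficient_zero[of 3 5] n3 by (simp add: e_weight_def)

  \<comment> \<open>The image of $[e_2,e_2]$, a combination of $e_4, \dots, e_n$, contains no $e_3$; but the product
    rule produces \<open>c\<close> times $e_3$ from the term $[e_2, c e_1]$.\<close>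
  have ex: "br (e i) x \<in> F (2 * i - 2)" if "3 \<le> i" for i
    using that
  proof (induction i rule: nat_induct_at_least)
    case base
    have "br (e 3) x = scale (4 * a) (e 3) + (br (e 3) x - scale (4 * a) (e 3))" by simp
    also have "\<dots> \<in> F 4"
      using A F_antimono[of 4 5] by (intro F_rules(1,3) e_in_F) (auto simp: e_weight_def)
    finally show ?case by simp
  next
    case (Suc i)
    have "br (br (e i) (e 1)) x = br (e i) (br (e 1) x) + br (br (e i) x) (e 1)"
      using derivation_even[OF e_even x0, of "e i" 1] .
    then have "br (e (Suc i)) x = scale (2 * a) (e (Suc i)) + br (br (e i) x) (e 1)"
      using Suc.hyps ee1[of i] br_F_3_right[OF e0 t] by (simp add: e1x'[simplified] br_bilinear)
    moreover have "br (br (e i) x) (e 1) \<in> F (2 * Suc i - 2)"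
    proof -
      have "2 * i - 2 + 2 = 2 * Suc i - 2" using Suc.hyps by simp
      then show ?thesis using br_F_generators(2)[OF Suc.IH] by simp
    qed
    moreover have "e (Suc i) \<in> F (2 * Suc i - 2)"
      using Suc.hyps by (intro e_in_F) (simp add: e_weight_def)
    ultimately show ?case using F_rules(1,3) by simp
  qed
  have e22: "br (e 2) (e 2) = (\<Sum>k=4..n. scale (\<alpha> k) (e k))"
    using ee2[of 2] by simp
  have "br (e k) x \<in> F 5" if "4 \<le> k" for k
  proof -
    have "5 \<le> 2 * k - 2" "3 \<le> k" using that by linarith+
    then show ?thesis using subsetD[OF F_antimono ex] by simp
  qed
  then have "br (\<Sum>k=4..n. scale (\<alpha> k) (e k)) x \<in> F 5"
    by (auto simp: br_sum_left br_scale_left intro!: F_rules(3,4))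
  then have B: "br (br (e 2) (e 2)) x \<in> F 5" by (simp only: e22)
  have S: "(\<Sum>k=4..n. scale (\<alpha> k) (e k)) \<in> F 5"
    by (intro F_rules(3,4) e_in_F) (auto simp: e_weight_def)
  have "br (br (e 2) (e 2)) x = br (e 2) (br (e 2) x) + br (br (e 2) x) (e 2)"
    using derivation_even[OF e_even x0, of "e 2" 2] .
  then have "br (br (e 2) (e 2)) x = scale c (e 3)
      + (scale (2 * b + c) (\<Sum>k=4..n. scale (\<alpha> k) (e k)) + br r (e 2))"
    using br_F_3_right[OF e0 r]
    by (simp only: e2x br_bilinear e21 e22 e1e2) (simp add: algebra_simps flip: scale_left_distrib)
  moreover have "scale (2 * b + c) (\<Sum>k=4..n. scale (\<alpha> k) (e k)) + br r (e 2) \<in> F 5"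
    using br_F_generators(3)[OF r] S by (intro F_rules(1,3)) simp_all
  ultimately have "scale c (e 3) \<in> F 5"
    using F_rules(2)[OF B] by (metis add_diff_cancel_right')
  then have "c = 0"
    using e_coefficient_zero[of 3 5] n3 by (simp add: e_weight_def)
  then have "b = 2 * a" using abc by simp
  then have "br (e 2) x - scale (2 * a) (e 2) \<in> F 3" using bc \<open>c = 0\<close> by simp
  moreover have "br (y 1) x - scale a (y 1) \<in> F 2" using a F_antimono[of 2 3] by auto
  ultimately show ?thesis using e1x unfolding acts_with_eigenvalue_def by blast
qed

section \<open>Vanishing of the parameters\<close>

text \<open>
  Let \<open>m\<close> be such that all earlier \<open>\<alpha>\<close> vanish. By the product rule, \<open>x\<close> acts on $[e_2,e_2]$ as $4a$
  modulo vectors heavier than $e_m$, whereas on its leading term $\alpha_m e_m$ it acts as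
  $(2m-2)a$.
\<close>

lemma nonzero_eigenvalue_\<alpha>_zero:
  assumes x: "x \<in> L0" and a: "acts_with_eigenvalue a x" "a \<noteq> 0"
  shows "4 \<le> m \<Longrightarrow> m \<le> n \<Longrightarrow> \<alpha> m = 0"
proof (induction m rule: less_induct)
  case (less m)
  have x0: "x \<in> homog L0 L1 0" using x by (simp add: homog_def)
  define r where "r = br (e 2) x - scale (2 * a) (e 2)"
  have r: "r \<in> F 3" using a by (simp add: acts_with_eigenvalue_def r_def)
  have e2x: "br (e 2) x = scale (2 * a) (e 2) + r" by (simp add: r_def)
  \<comment> \<open>Multiplication by $e_2$ involves only the $\alpha_k$ with $k \ge m$ and shifts indices by
    $k - 2$; since \<open>r\<close> is heavier than $e_2$, the result is heavier than $e_m$.\<close>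
  have "br r (e 2) \<in> F (2 * m - 1)"
  proof (rule br_span_left[OF r[unfolded F_def] subspace_F])
    fix b assume "b \<in> {e i | i. 3 \<le> e_weight i} \<union> {y i | i. 3 \<le> y_weight i}"
    then consider i where "b = e i" "3 \<le> i" | i where "b = y i" "2 \<le> i"
      by (fastforce simp: e_weight_def y_weight_def split: if_splits)
    then show "br b (e 2) \<in> F (2 * m - 1)"
    proof cases
      case 1
      have "scale (\<alpha> k) (e (k + i - 2)) \<in> F (2 * m - 1)" if "k \<in> {4..n}" for k
        using that less 1 F_rules(5)
        by (cases "k < m") (auto simp: e_weight_def intro!: F_rules(3) e_in_F)
      then have "(\<Sum>k=4..n. scale (\<alpha> k) (e (k + i - 2))) \<in> F (2 * m - 1)"
        by (rule F_rules(4))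
      then show ?thesis using 1 ee2[of i] by simp
    next
      case 2
      have "scale (\<alpha> k) (y (k + i - 2)) \<in> F (2 * m - 1)" if "k \<in> {4..n}" for k
        using that less 2 F_rules(5)
        by (cases "k < m") (auto simp: y_weight_def intro!: F_rules(3) y_in_F)
      then have "(\<Sum>k=4..n. scale (\<alpha> k) (y (k + i - 2))) \<in> F (2 * m - 1)"
        by (rule F_rules(4))
      then show ?thesis using 2 ye2[of i] by simp
    qed
  qed
  define t where "t k = scale (\<alpha> k) (br (e k) x - scale (4 * a) (e k))" for k
  have e22: "br (e 2) (e 2) = (\<Sum>k=4..n. scale (\<alpha> k) (e k))"
    using ee2[of 2] by simp
  have "br (br (e 2) (e 2)) x = br (e 2) (br (e 2) x) + br (br (e 2) x) (e 2)"
    using derivation_even[OF e_even x0, of "e 2" 2] .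
  then have "br (br (e 2) (e 2)) x - scale (4 * a) (br (e 2) (e 2)) = br r (e 2)"
    using br_F_3_right[OF e_in_F r]
    by (simp only: e2x br_bilinear) (simp add: algebra_simps flip: scale_left_distrib)
  moreover have "br (br (e 2) (e 2)) x - scale (4 * a) (br (e 2) (e 2)) = (\<Sum>k=4..n. t k)"
    unfolding e22 t_def
    by (simp add: br_sum_left br_scale_left scale_sum_right scale_right_diff_distrib
        sum_subtractf mult.commute)
  ultimately have "(\<Sum>k=4..n. t k) \<in> F (2 * m - 1)"
    using \<open>br r (e 2) \<in> F (2 * m - 1)\<close> by simp
  moreover have "(\<Sum>k=4..n. t k) = t m + (\<Sum>k\<in>{4..n} - {m}. t k)"
    using less.prems by (intro sum.remove) auto
  moreover have "(\<Sum>k\<in>{4..n} - {m}. t k) \<in> F (2 * m - 1)"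
  proof (rule F_rules(4))
    fix k assume k: "k \<in> {4..n} - {m}"
    show "t k \<in> F (2 * m - 1)"
    proof (cases "k < m")
      case True
      then show ?thesis using less.IH k F_rules(5) by (simp add: t_def)
    next
      case False
      then have w: "2 * m - 1 \<le> e_weight k" using k by (auto simp: e_weight_def)
      have "br (e k) x - scale (4 * a) (e k)
          = (br (e k) x - scale (of_nat (e_weight k) * a) (e k))
            + scale (of_nat (e_weight k) * a - 4 * a) (e k)"
        by (simp add: scale_left_diff_distrib)
      also have "\<dots> \<in> F (2 * m - 1)"
        using eigenvalue_on_basis(1)[OF x0 a(1), of k] k w
          F_antimono[of "2 * m - 1" "e_weight k + 1"]
        by (intro F_rules(1,3) e_in_F) auto
      finally show ?thesis unfolding t_def by (rule F_rules(3))
    qed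
  qed
  ultimately have tm: "t m \<in> F (2 * m - 1)"
    using F_rules(2) by (metis add_diff_cancel_right')
  have "e_weight m + 1 = 2 * m - 1" using less.prems by (simp add: e_weight_def)
  then have "br (e m) x - scale (of_nat (e_weight m) * a) (e m) \<in> F (2 * m - 1)"
    using eigenvalue_on_basis(1)[OF x0 a(1), of m] less.prems by simp
  from F_rules(2)[OF tm F_rules(3)[OF this, of "\<alpha> m"]]
  have "scale (\<alpha> m * (of_nat (e_weight m) * a - 4 * a)) (e m) \<in> F (2 * m - 1)"
    by (simp add: t_def scale_right_diff_distrib scale_left_diff_distrib right_diff_distrib)
  then have "\<alpha> m * (of_nat (e_weight m) * a - 4 * a) = 0"
    using less.prems by (intro e_coefficient_zero[of m "2 * m - 1"]) (auto simp: e_weight_def)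
  moreover have "of_nat (e_weight m) * a - 4 * a \<noteq> 0"
  proof -
    have "of_nat (e_weight m) \<noteq> (of_nat 4 :: complex)"
      using less.prems by (subst of_nat_eq_iff) (auto simp: e_weight_def)
    then show ?thesis using a(2) by (simp flip: left_diff_distrib)
  qed
  ultimately show ?case by simp
qed

text \<open>
  With all \<open>\<alpha>\<close> gone, $[y_1,e_2] = \tau y_n$ is the only remaining product with right factor $e_2$, so
  \<open>x\<close> acts on it exactly as $3a$; but $y_n$, as the heaviest basis vector, is an exact eigenvector
  with eigenvalue $(2n-1)a$.
\<close>

lemma nonzero_eigenvalue_\<tau>_zero:
  assumes x: "x \<in> L0" and a: "acts_with_eigenvalue a x" "a \<noteq> 0"
  shows "\<tau> = 0"
proof -
  have x0: "x \<in> homog L0 L1 0" using x by (simp add: homog_def)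
  have \<alpha>0: "\<alpha> k = 0" if "k \<in> {4..n}" for k
    using nonzero_eigenvalue_\<alpha>_zero[OF x a] that by simp
  define r where "r = br (e 2) x - scale (2 * a) (e 2)"
  have r: "r \<in> F 3" using a by (simp add: acts_with_eigenvalue_def r_def)
  have e2x: "br (e 2) x = scale (2 * a) (e 2) + r" by (simp add: r_def)
  define s where "s = br (y 1) x - scale a (y 1)"
  have s: "s \<in> F 2" using a by (simp add: acts_with_eigenvalue_def s_def)
  have y1x: "br (y 1) x = scale a (y 1) + s" by (simp add: s_def)
  have "br s (e 2) \<in> {0}"
  proof (rule br_span_left[OF s[unfolded F_def] subspace_single_0])
    fix b assume "b \<in> {e i | i. 2 \<le> e_weight i} \<union> {y i | i. 2 \<le> y_weight i}"
    then consider "b = e 1" | i where "b = e i" "2 \<le> i" | i where "b = y i" "2 \<le> i"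
      by (fastforce simp: e_weight_def y_weight_def split: if_splits)
    then show "br b (e 2) \<in> {0}"
      by cases (simp_all add: e1e2[simplified] ee2 ye2 \<alpha>0)
  qed
  then have se2: "br s (e 2) = 0" by simp
  have y1e2': "br (y 1) (e 2) = scale \<tau> (y n)" by (simp add: y1e2[simplified] \<alpha>0)
  have "br (br (y 1) (e 2)) x = br (y 1) (br (e 2) x) + br (br (y 1) x) (e 2)"
    using derivation_even[OF e_even x0, of "y 1" 2] .
  then have "scale \<tau> (br (y n) x) = scale (\<tau> * (3 * a)) (y n)"
    using br_F_3_right[OF y_in_F r] se2
    by (simp only: e2x y1x br_bilinear y1e2') (simp add: algebra_simps flip: scale_left_distrib)
  moreover have "br (y n) x - scale (of_nat (y_weight n) * a) (y n) \<in> F (2 * n)"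
    using eigenvalue_on_basis(2)[OF x0 a(1), of n] n3 by (simp add: y_weight_def)
  then have "br (y n) x = scale (of_nat (y_weight n) * a) (y n)" by (simp add: F_top)
  ultimately have "scale \<tau> (scale (of_nat (y_weight n) * a) (y n)) = scale (\<tau> * (3 * a)) (y n)"
    by (simp only:)
  then have "scale (\<tau> * (of_nat (y_weight n) * a - 3 * a)) (y n) = 0"
    by (simp only: right_diff_distrib scale_left_diff_distrib scale_scale diff_self)
  then have "scale (\<tau> * (of_nat (y_weight n) * a - 3 * a)) (y n) \<in> F (2 * n)"
    by (simp only: F_rules(5))
  then have "\<tau> * (of_nat (y_weight n) * a - 3 * a) = 0"
    using n3 by (intro y_coefficient_zero[of n "2 * n"]) (auto simp: y_weight_def)
  moreover have "of_nat (y_weight n) * a - 3 * a \<noteq> 0"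
  proof -
    have "of_nat (y_weight n) \<noteq> (of_nat 3 :: complex)"
      using n3 by (subst of_nat_eq_iff) (auto simp: y_weight_def)
    then show ?thesis using a(2) by (simp flip: left_diff_distrib)
  qed
  ultimately show ?thesis by simp
qed

lemma nilradical_parameters_zero:
  assumes N: "nilradical (F 0)" and L: "\<not> nilpotent UNIV"
  shows "\<forall>k\<in>{4..n}. \<alpha> k = 0" and "\<tau> = 0"
proof -
  have prod: "br u v \<in> F 0" for u v
    using N by (auto simp: nilradical_def prod_space_def intro: span_base)
  have "F 0 \<noteq> UNIV" using N L by (auto simp: nilradical_def)
  then obtain d x where x: "x \<in> homog L0 L1 d" "x \<notin> F 0"
    using ex_homogeneous_outside[OF subspace_F] by blast
  have no0: "\<not> acts_with_eigenvalue 0 x"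
    using eigenvalue_0_nilpotent[OF x(1) _ prod] nilradical_adjoin_not_nilpotent[OF N x] by blast
  then have x0: "x \<in> L0"
    using odd_acts_with_eigenvalue_0[OF _ prod] x(1) by (auto simp: homog_def split: if_splits)
  obtain a where a: "acts_with_eigenvalue a x"
    using even_acts_with_eigenvalue[OF x0 prod] by blast
  with no0 have "a \<noteq> 0" by blast
  then show "\<forall>k\<in>{4..n}. \<alpha> k = 0" and "\<tau> = 0"
    using nonzero_eigenvalue_\<alpha>_zero[OF x0 a] nonzero_eigenvalue_\<tau>_zero[OF x0 a] by auto
qed

lemma F_0: "F 0 = span (range e \<union> range y)"
  by (simp add: F_def full_SetCompr_eq)

end

section \<open>Reduction to the normal form of the table\<close>

context leibniz_superalgebra
begin

text \<open>
  The superidentity for $e_2, e_2, y_1$ gives $\frac12 [y_2,e_2] = [[e_2,e_2],y_1]$, since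
  $[e_2,y_2] = 0$. The right-hand side is $\frac12\sum_{k=4}^n \alpha_k y_k$, and comparing with the
  table entry for $[y_2,e_2]$ determines $\theta$.
\<close>

lemma is_M_imp_M_table:
  assumes n: "n \<ge> 3" and M: "is_M n \<alpha> \<theta> \<tau> N"
  obtains e y where "M_table scale L0 L1 br n \<alpha> \<tau> e y" "N = span (range e \<union> range y)"
    "\<theta> = (if 4 \<le> n then \<alpha> n else 0)"
proof -
  obtain e y where gN: "graded_subspace N"
    and eB: "is_basis_of n e (N \<inter> L0)" and yB: "is_basis_of n y (N \<inter> L1)"
    and tab: "\<And>i j. i \<in> {1..n} \<Longrightarrow> j \<in> {1..n} \<Longrightarrow>
           br (e i) (e j) = M_ee n \<alpha> \<theta> e i j \<and>
           br (e i) (y j) = M_ey n y i j \<and>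
           br (y i) (e j) = M_ye n \<alpha> \<theta> \<tau> y i j \<and>
           br (y i) (y j) = M_yy n e i j"
    using M unfolding is_M_def by blast
  have inN: "e i \<in> N \<inter> L0" "y i \<in> N \<inter> L1" if "i \<in> {1..n}" for i
    using eB yB that span_base[of "e i" "e ` {1..n}"] span_base[of "y i" "y ` {1..n}"]
    by (auto simp: is_basis_of_def)
  have yn: "y n \<noteq> 0"
  proof
    assume "y n = 0"
    moreover have "y n \<in> y ` {1..n}" using n by (intro imageI) simp
    ultimately have "0 \<in> y ` {1..n}" by simp
    then show False using yB dependent_zero by (auto simp: is_basis_of_def)
  qed

  have e22: "br (e 2) (e 2) = (\<Sum>k=4..n. scale (\<alpha> k) (e k))"
    using tab[of 2 2] n by (simp add: M_ee_def)
  have ey1: "br (e k) (y 1) = scale (1/2) (y k)" if "2 \<le> k" "k \<le> n" for k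
    using tab[of k 1] that by (simp add: M_ey_def)
  have y2e2: "br (y 2) (e 2) = (\<Sum>k=4..n-1. scale (\<alpha> k) (y k)) + scale \<theta> (y n)"
    using tab[of 2 2] n by (simp add: M_ye_def)
  have "br (e 2) (br (e 2) (y 1)) = br (br (e 2) (e 2)) (y 1) - br (br (e 2) (y 1)) (e 2)"
    using super_leibniz[of "e 2" 0 "y 1" 1 "e 2"] inN n by (simp add: homog_def)
  moreover have "br (e 2) (y 2) = 0" using tab[of 2 2] n by (simp add: M_ey_def)
  ultimately have "scale (1/2) (br (y 2) (e 2)) = br (br (e 2) (e 2)) (y 1)"
    using ey1[of 2] n by (simp add: br_scale_left br_scale_right)
  also have "\<dots> = scale (1/2) (\<Sum>k=4..n. scale (\<alpha> k) (y k))"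
    unfolding e22 br_sum_left scale_sum_right
    by (intro sum.cong) (simp_all add: br_scale_left ey1[simplified] mult.commute)
  finally have "br (y 2) (e 2) = (\<Sum>k=4..n. scale (\<alpha> k) (y k))"
    by (simp add: scale_left_imp_eq)
  with y2e2 have sum_eq:
    "(\<Sum>k=4..n-1. scale (\<alpha> k) (y k)) + scale \<theta> (y n) = (\<Sum>k=4..n. scale (\<alpha> k) (y k))" by simp
  \<comment> \<open>For \<open>n = 3\<close> the sums are empty and there is no last term to split off.\<close>
  have split_last: "(\<Sum>k=4..n. scale (\<alpha> k) (f k))
      = (\<Sum>k=4..n-1. scale (\<alpha> k) (f k)) + (if 4 \<le> n then scale (\<alpha> n) (f n) else 0)" for f
    using n by (cases n) auto
  have \<theta>: "\<theta> = (if 4 \<le> n then \<alpha> n else 0)"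
    using sum_eq yn unfolding split_last[of y] by (auto split: if_splits)

  define e' where "e' i = (if i \<in> {1..n} then e i else 0)" for i
  define y' where "y' i = (if i \<in> {1..n} then y i else 0)" for i
  have shifted: "(\<Sum>k=4..n. scale (\<alpha> k) (f (k + i - 2)))
      = (\<Sum>k=4..n+2-i. scale (\<alpha> k) (g (k + i - 2)))"
    if "2 \<le> i" "\<And>k. f k = (if k \<in> {1..n} then g k else 0)" for f g i
    by (rule sum.mono_neutral_cong_right) (use that in auto)
  have "M_table scale L0 L1 br n \<alpha> \<tau> e' y'"
  proof (rule M_table.intro[OF leibniz_superalgebra_axioms M_table_axioms.intro])
    show "n \<ge> 3" by fact
    show "e' i \<in> L0" "y' i \<in> L1" for i
      using inN subspace_0[OF subspace_even] subspace_0[OF subspace_odd]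
      by (auto simp: e'_def y'_def)
    show "e' i = 0" "y' i = 0" if "i \<notin> {1..n}" for i
      using that by (auto simp: e'_def y'_def)
    have im: "e' ` {1..n} = e ` {1..n}" "y' ` {1..n} = y ` {1..n}"
      by (auto simp: e'_def y'_def)
    show "independent (e' ` {1..n})" "independent (y' ` {1..n})"
      using eB yB unfolding im is_basis_of_def by - (elim conjE, assumption)+
    have "inj_on e' {1..n} = inj_on e {1..n}" "inj_on y' {1..n} = inj_on y {1..n}"
      by (rule inj_on_cong, simp add: e'_def y'_def)+
    then show "inj_on e' {1..n}" "inj_on y' {1..n}"
      using eB yB unfolding is_basis_of_def by blast+
    have one: "e' 1 = e 1" "y' 1 = y 1" and two: "e' 2 = e 2" "y' 2 = y 2"
      and three: "e' 3 = e 3"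
      using n by (simp_all add: e'_def y'_def)
    show "br (e' 1) (e' 1) = e' 3" "br (e' 1) (y' 1) = scale (1/2) (y' 2)"
      "br (y' 1) (y' 1) = e' 1"
      unfolding one two three using tab[of 1 1] n by (simp_all add: M_ee_def M_ey_def M_yy_def)
    \<comment> \<open>The bounds appear in two forms because the given table tests for \<open>i \<le> n - 1\<close>.\<close>
    have range_cases: Q
      if "i < n \<Longrightarrow> i \<le> n - 1 \<Longrightarrow> Q" "i = n \<Longrightarrow> \<not> n \<le> n - 1 \<Longrightarrow> Q" "n < i \<Longrightarrow> Q" for i Q
      using that n by linarith
    show "br (y' i) (e' 1) = y' (i + 1)" if i: "1 \<le> i" for i
    proof (rule range_cases[of i])
      assume "i < n" "i \<le> n - 1"
      then show ?thesis unfolding one using i tab[of i 1] n by (simp add: y'_def M_ye_def)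
    next
      assume "i = n" "\<not> n \<le> n - 1"
      then show ?thesis unfolding one using tab[of n 1] n by (simp add: y'_def M_ye_def)
    qed (simp add: y'_def)
    fix i :: nat
    assume i: "2 \<le> i"
    show "br (e' i) (e' 1) = e' (i + 1)"
    proof (rule range_cases[of i])
      assume "i < n" "i \<le> n - 1"
      then show ?thesis unfolding one using i tab[of i 1] n by (simp add: e'_def M_ee_def)
    next
      assume "i = n" "\<not> n \<le> n - 1"
      then show ?thesis unfolding one using tab[of n 1] n by (simp add: e'_def M_ee_def)
    qed (simp add: e'_def)
    show "br (e' i) (y' 1) = scale (1/2) (y' i)"
      unfolding one using i tab[of i 1] n by (cases "i \<le> n") (simp_all add: e'_def y'_def M_ey_def)
    show "br (y' i) (y' 1) = e' (i + 1)"
    proof (rule range_cases[of i])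
      assume "i < n" "i \<le> n - 1"
      then show ?thesis unfolding one using i tab[of i 1] n by (simp add: e'_def y'_def M_yy_def)
    next
      assume "i = n" "\<not> n \<le> n - 1"
      then show ?thesis unfolding one using tab[of n 1] n by (simp add: e'_def y'_def M_yy_def)
    qed (simp add: e'_def y'_def)
    show "br (e' i) (e' 2) = (\<Sum>k=4..n. scale (\<alpha> k) (e' (k + i - 2)))"
      unfolding shifted[OF i e'_def] two
    proof (cases "i \<le> n")
      case True
      then show "br (e' i) (e 2) = (\<Sum>k=4..n+2-i. scale (\<alpha> k) (e (k + i - 2)))"
        using i tab[of i 2] n by (cases "i \<le> n - 2") (simp_all add: e'_def M_ee_def)
    qed (simp add: e'_def)
    show "br (y' i) (e' 2) = (\<Sum>k=4..n. scale (\<alpha> k) (y' (k + i - 2)))"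
      unfolding shifted[OF i y'_def] two
    proof (cases "i \<le> n")
      case True
      show "br (y' i) (e 2) = (\<Sum>k=4..n+2-i. scale (\<alpha> k) (y (k + i - 2)))"
      proof (cases "i = 2")
        case True
        then show ?thesis using y2e2 sum_eq two by simp
      next
        case False
        then show ?thesis
          using \<open>i \<le> n\<close> i tab[of i 2] n
          by (cases "i \<le> n - 2") (simp_all add: y'_def M_ye_def)
      qed
    qed (simp add: y'_def)
  next
    have one: "e' 1 = e 1" "y' 1 = y 1" and two: "e' 2 = e 2" and last: "y' n = y n" "e' n = e n"
      using n by (simp_all add: e'_def y'_def)
    have e': "(\<Sum>k=4..n-1. scale (\<alpha> k) (e' k)) = (\<Sum>k=4..n-1. scale (\<alpha> k) (e k))"
      by (rule sum.cong) (auto simp: e'_def)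
    have y': "(\<Sum>k=4..n-1. scale (\<alpha> k) (y' (k - 1))) = (\<Sum>k=4..n-1. scale (\<alpha> k) (y (k - 1)))"
      by (rule sum.cong) (auto simp: y'_def)
    show "br (e' 1) (e' 2) = (\<Sum>k=4..n. scale (\<alpha> k) (e' k))"
      unfolding split_last[of e'] e' one two last
      using tab[of 1 2] n \<theta> by (simp add: M_ee_def)
    have "n - 1 \<in> {1..n}" using n by simp
    then have "y' (n - 1) = y (n - 1)" by (simp only: y'_def if_True)
    then show "br (y' 1) (e' 2) = (\<Sum>k=4..n. scale (\<alpha> k) (y' (k - 1))) + scale \<tau> (y' n)"
      unfolding split_last[of "\<lambda>k. y' (k - 1)"] y' one two last
      using tab[of 1 2] n \<theta> by (simp add: M_ye_def)
    show "br (e' i) (e' j) = 0" "br (y' i) (e' j) = 0" if "3 \<le> j" for i j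
      using that tab[of i j] by (simp_all add: e'_def y'_def M_ee_def M_ye_def)
    show "br (e' i) (y' j) = 0" "br (y' i) (y' j) = 0" if "2 \<le> j" for i j
      using that tab[of i j] by (simp_all add: e'_def y'_def M_ey_def M_yy_def)
  qed
  moreover have "N = span (range e' \<union> range y')"
  proof
    have sub: "subspace N" using gN by (simp add: graded_subspace_def)
    have "e' i \<in> N" "y' i \<in> N" for i
      using inN subspace_0[OF sub] by (auto simp: e'_def y'_def)
    then show "span (range e' \<union> range y') \<subseteq> N"
      by (intro span_minimal sub) auto
    have "e i \<in> range e' \<union> range y'" "y i \<in> range e' \<union> range y'" if "i \<in> {1..n}" for i
      using that rangeI[of e' i] rangeI[of y' i] by (auto simp: e'_def y'_def)
    then have "e ` {1..n} \<subseteq> range e' \<union> range y'" "y ` {1..n} \<subseteq> range e' \<union> range y'"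
      by (simp_all only: image_subset_iff, blast+)
    from this[THEN span_mono]
    have "N \<inter> L0 \<subseteq> span (range e' \<union> range y')" "N \<inter> L1 \<subseteq> span (range e' \<union> range y')"
      using eB yB unfolding is_basis_of_def by simp_all
    moreover have "\<exists>u\<in>N \<inter> L0. \<exists>v\<in>N \<inter> L1. z = u + v" if "z \<in> N" for z
      using gN that by (simp add: graded_subspace_def)
    ultimately show "N \<subseteq> span (range e' \<union> range y')"
      by (fast intro: span_add)
  qed
  ultimately show thesis using \<theta> by (rule that)
qed

end

theorem corollary4p8:
  fixes scale :: "complex \<Rightarrow> 'a::ab_group_add \<Rightarrow> 'a"
    and L0 L1 :: "'a set"
    and br :: "'a \<Rightarrow> 'a \<Rightarrow> 'a"
    and n :: nat
    and \<alpha> :: "nat \<Rightarrow> complex"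
    and \<theta> \<tau> :: complex
    and N :: "'a set"
  assumes "n \<ge> 3"
    and "leibniz_superalgebra scale L0 L1 br"
    and "\<not> leibniz_superalgebra.nilpotent scale br (UNIV :: 'a set)"
    and "leibniz_superalgebra.solvable scale br (UNIV :: 'a set)"
    and "leibniz_superalgebra.nilradical scale L0 L1 br N"
    and "leibniz_superalgebra.is_M scale L0 L1 br n \<alpha> \<theta> \<tau> N"
  shows "(\<forall>k\<in>{4..n}. \<alpha> k = 0) \<and> \<theta> = 0 \<and> \<tau> = 0"
proof -
  interpret leibniz_superalgebra scale L0 L1 br by fact
  obtain e y where table: "M_table scale L0 L1 br n \<alpha> \<tau> e y"
    and N: "N = span (range e \<union> range y)" and \<theta>: "\<theta> = (if 4 \<le> n then \<alpha> n else 0)"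
    using is_M_imp_M_table[OF assms(1,6)] .
  interpret M_table scale L0 L1 br n \<alpha> \<tau> e y by fact
  have "nilradical (F 0)" using assms(5) by (simp only: N F_0)
  from nilradical_parameters_zero[OF this assms(3)] \<theta> show ?thesis by simp
qed

end
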